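(* Let $L$ and $K$ be even lattices, let $v\in\operatorname{Gr}(L_{\mathbb{R}})$ and $w\in\operatorname{Gr}(K_{\mathbb{R}})$, and let $\Gamma$ be a finite index subgroup of $\operatorname{Mp}_2(\mathbb{Z})$. Let $F$ be a modular form of weight $(k,l)$ and representation $\rho_L^*$ with respect to $\Gamma$, and let $H$ be a modular form of weight $(\kappa,\mu)$ and representation $\rho_K^*$ with respect to $\Gamma$, where $k,l,\kappa,\mu\in\frac12\mathbb{Z}$. Then for every $\tau\in\mathcal{H}$, $\zeta\in L_{\mathbb{C}}$ and $\xi\in K_{\mathbb{C}}$, $$\Phi_{L\oplus K,v\oplus w}^{F\otimes H}(\tau,\zeta+\xi)=\Phi_{L,v}^{F}(\tau,\zeta)\cdot\Phi_{K,w}^{H}(\tau,\xi).$$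
   Context: Lattices. An even lattice is a free $\mathbb{Z}$-module $L$ of finite rank with a non-degenerate symmetric bilinear form $(\cdot,\cdot):L\times L\to\mathbb{Z}$ such that $\lambda^2:=(\lambda,\lambda)$ is even for every $\lambda\in L$. Put $L_{\mathbb{R}}=L\otimes\mathbb{R}$, $L_{\mathbb{C}}=L\otimes\mathbb{C}$; the pairing and $\lambda\mapsto\lambda^2$ are extended bilinearly (no complex conjugation). The signature $(b_+,b_-)$ of $L$ is that of $L_{\mathbb{R}}$. The dual lattice is $L^*=\{\lambda\in L_{\mathbb{R}}:(\lambda,L)\subseteq\mathbb{Z}\}\supseteq L$, and $D_L=L^*/L$ is a finite group. $\mathbb{C}[D_L]$ has basis $\{\mathfrak{e}_\gamma\}_{\gamma\in D_L}$. Write $\mathbf{e}(w)=e^{2\pi iw}$ and $\mathcal{H}=\{\tau=x+iy\in\mathbb{C}:y>0\}$. $\operatorname{Gr}(L_{\mathbb{R}})$ is the set of orthogonal decompositions $v$: $L_{\mathbb{R}}=v_+\oplus v_-$ with $v_+$ positive definite and $v_-$ negative definite; $\lambda_{v_\pm}$ is the orthogonal projection of $\lambda$ onto $v_\pm$. The Jacobi--Siegel theta function: for $\tau\in\mathcal{H}$, $\zeta\in L_{\mathbb{C}}$, $$\Theta_L(\tau,\zeta;v)=\sum_{\gamma\in D_L}\Big[\sum_{\lambda\in L+\gamma}\mathbf{e}\Big(\tau\tfrac{\lambda_{v_+}^2}{2}+\overline{\tau}\tfrac{\lambda_{v_-}^2}{2}+(\lambda,\zeta)\Big)\Big]\mathfrak{e}_\gamma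 .$$ Metaplectic group. For $A=\begin{pmatrix}a&b\\c&d\end{pmatrix}\in\operatorname{SL}_2(\mathbb{R})$ put $A\tau=\frac{a\tau+b}{c\tau+d}$, $j(A,\tau)=c\tau+d$. $\operatorname{Mp}_2(\mathbb{R})$ is the group of pairs $(A,\phi)$ with $A\in\operatorname{SL}_2(\mathbb{R})$, $\phi:\mathcal{H}\to\mathbb{C}$ holomorphic, $\phi^2(\tau)=j(A,\tau)$, with product $(A,\phi)(B,\psi)=(AB,(\phi\circ B)\psi)$; $\operatorname{Mp}_2(\mathbb{Z})$ is the inverse image of $\operatorname{SL}_2(\mathbb{Z})$. It is generated by $T=\big(\begin{pmatrix}1&1\\0&1\end{pmatrix},1\big)$ and $S=\big(\begin{pmatrix}0&-1\\1&0\end{pmatrix},\sqrt{\tau}\big)$ with $\sqrt\tau\in\mathcal{H}$. The Weil representation $\rho_L$ of $\operatorname{Mp}_2(\mathbb{Z})$ on $\mathbb{C}[D_L]$ is given by $$\rho_L(T)\mathfrak{e}_\gamma=\mathbf{e}(\tfrac{\gamma^2}{2})\mathfrak{e}_\gamma,\qquad \rho_L(S)\mathfrak{e}_\gamma=\frac{\mathbf{e}\big(\frac{b_--b_+}{8}\big)}{\sqrt{|D_L|}}\sum_{\delta\in D_L}\mathbf{e}(-(\gamma,\delta))\mathfrak{e}_\delta .$$ $L(-1)$ is $L$ with the forms negated; $\mathbb{C}[D_{L(-1)}]$ has basis $\{\mathfrak{e}_\gamma^*\}_{\gamma\in D_L}$, regarded as dual to $\{\mathfrak{e}_\gamma\}$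 via the bilinear pairing $\langle\cdot,\cdot\rangle_L:\mathbb{C}[D_L]\times\mathbb{C}[D_{L(-1)}]\to\mathbb{C}$, $\langle\mathfrak{e}_\gamma,\mathfrak{e}_\delta^*\rangle_L=\delta_{\gamma,\delta}$. $\rho_L^*=\rho_{L(-1)}$ is the dual representation: $\langle\rho_L(A,\phi)U,\rho_L^*(A,\phi)V\rangle_L=\langle U,V\rangle_L$. Modular forms. For $p,q\in\frac12\mathbb{Z}$, a modular form of weight $(p,q)$ and representation $\rho_L^*$ with respect to $\Gamma$ is a smooth $F:\mathcal{H}\to\mathbb{C}[D_{L(-1)}]$ with $F(A\tau)=\phi(\tau)^{2p}\overline{\phi(\tau)}^{2q}\rho_L^*(A,\phi)F(\tau)$ for all $\tau\in\mathcal{H}$, $(A,\phi)\in\Gamma$, and with at most linear exponential growth at the cusps (for every $A\in\operatorname{SL}_2(\mathbb{Z})$ there is $C$ with $F(A\tau)=O(e^{Cy})$ as $y\to\infty$, uniformly for $x$ in bounded sets). For such $F$ put $\Phi_{L,v}^F(\tau,\zeta)=\langle\Theta_L(\tau,\zeta;v),F(\tau)\rangle_L$ for $(\tau,\zeta)\in\mathcal{H}\times L_{\mathbb{C}}$ (and similarly for any even lattice). Direct sums. $L\oplus K$ is the orthogonal direct sum, so $D_{L\oplus K}=D_L\oplus D_K$, $\mathbb{C}[D_{L\oplus K}]=\mathbb{C}[D_L]\otimes\mathbb{C}[D_K]$ (with $\mathfrak{e}_{(\gamma,\delta)}=\mathfrak{e}_\gamma\otimes\mathfrak{e}_\delta$),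 $\rho_{L\oplus K}=\rho_L\otimes\rho_K$, and similarly for the duals. $v\oplus w\in\operatorname{Gr}(L_{\mathbb{R}}\oplus K_{\mathbb{R}})$ has spaces $(v\oplus w)_\pm=v_\pm\oplus w_\pm$. $(F\otimes H)(\tau)=F(\tau)\otimes H(\tau)$ is a modular form of weight $(k+\kappa,l+\mu)$ and representation $\rho_{L\oplus K}^*$ with respect to $\Gamma$. Elements of $(L\oplus K)_{\mathbb{C}}$ are written $\zeta+\xi$ with $\zeta\in L_{\mathbb{C}}$, $\xi\in K_{\mathbb{C}}$. *)

theory Defs
  imports "HOL-Analysis.Analysis" "HOL-Algebra.Group_Action"
begin

section \<open>Even lattices\<close>

text \<open>A lattice \<open>L\<close> is a subset \<open>pts L\<close> of a real vector space, namely the set of integral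
  combinations of a finite \<^emph>\<open>linearly independent\<close> set, so that \<open>L \<otimes> \<real>\<close> is \<open>span (pts L)\<close>. The rank
  may be 0, and the span need not be the whole ambient type. Values of \<open>form L\<close> outside the
  span are never used.\<close>

record 'a lat =
  pts :: "'a set"
  form :: "'a \<Rightarrow> 'a \<Rightarrow> real"

definition even_lattice :: "('a::real_vector) lat \<Rightarrow> bool" where
  "even_lattice L \<longleftrightarrow>
     (\<exists>B. finite B \<and> independent B \<and> pts L = {\<Sum>b\<in>B. of_int (c b) *\<^sub>R b |c :: 'a \<Rightarrow> int. True}) \<and>
     bilinear (form L) \<and>
     (\<forall>x\<in>pts L. \<forall>y\<in>pts L. form L x y = form L y x) \<and>
     (\<forall>x\<in>pts L. \<forall>y\<in>pts L. form L x y \<in> \<int>) \<and>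
     (\<forall>x\<in>pts L. (\<forall>y\<in>pts L. form L x y = 0) \<longrightarrow> x = 0) \<and>
     (\<forall>x\<in>pts L. \<exists>m::int. form L x x = 2 * of_int m)"

definition realspan :: "('a::real_vector) lat \<Rightarrow> 'a set" where
  "realspan L = span (pts L)"

definition dual_lattice :: "('a::real_vector) lat \<Rightarrow> 'a set" where
  "dual_lattice L = {x \<in> realspan L. \<forall>y\<in>pts L. form L x y \<in> \<int>}"

text \<open>An element of \<open>disc L\<close>, the underlying set of the discriminant group, is literally a coset
  \<open>L + \<gamma>\<close>.\<close>

definition disc :: "('a::real_vector) lat \<Rightarrow> 'a set set" where
  "disc L = dual_lattice L // {(x, y). x \<in> dual_lattice L \<and> y \<in> dual_lattice L \<and> x - y \<in> pts L}"

definition twist_neg :: "('a::real_vector) lat \<Rightarrow> 'a lat" where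
  "twist_neg L = L\<lparr>form := \<lambda>x y. - form L x y\<rparr>"

definition pos_definite_on :: "('a::real_vector) lat \<Rightarrow> 'a set \<Rightarrow> bool" where
  "pos_definite_on L W \<longleftrightarrow> (\<forall>x\<in>W. x \<noteq> 0 \<longrightarrow> form L x x > 0)"

definition neg_definite_on :: "('a::real_vector) lat \<Rightarrow> 'a set \<Rightarrow> bool" where
  "neg_definite_on L W \<longleftrightarrow> (\<forall>x\<in>W. x \<noteq> 0 \<longrightarrow> form L x x < 0)"

definition sig_pos :: "('a::real_vector) lat \<Rightarrow> nat" where
  "sig_pos L = Max {dim W |W. subspace W \<and> W \<subseteq> realspan L \<and> pos_definite_on L W}"

definition sig_neg :: "('a::real_vector) lat \<Rightarrow> nat" where
  "sig_neg L = Max {dim W |W. subspace W \<and> W \<subseteq> realspan L \<and> neg_definite_on L W}"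

text \<open>A point \<open>v\<close> of the Grassmannian is the pair \<open>(v\<^sub>+, v\<^sub>-)\<close>. That the sum is direct follows from
  definiteness.\<close>

definition Gr :: "('a::real_vector) lat \<Rightarrow> ('a set \<times> 'a set) set" where
  "Gr L = {(vp, vm). subspace vp \<and> subspace vm \<and>
     realspan L = {x + y |x y. x \<in> vp \<and> y \<in> vm} \<and>
     (\<forall>x\<in>vp. \<forall>y\<in>vm. form L x y = 0) \<and>
     pos_definite_on L vp \<and> neg_definite_on L vm}"

definition orth_proj :: "('a::real_vector) lat \<Rightarrow> 'a set \<Rightarrow> 'a \<Rightarrow> 'a" where
  "orth_proj L W x = (THE p. p \<in> W \<and> (\<forall>w\<in>W. form L (x - p) w = 0))"

text \<open>The complexification: \<open>Cx x y\<close> is \<open>x + \<i> y\<close>, and the form is extended without conjugation.\<close>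

datatype 'a complexified = Cx (re_part: 'a) (im_part: 'a)

definition cspan :: "('a::real_vector) lat \<Rightarrow> 'a complexified set" where
  "cspan L = {\<zeta>. re_part \<zeta> \<in> realspan L \<and> im_part \<zeta> \<in> realspan L}"

definition cform :: "('a::real_vector) lat \<Rightarrow> 'a complexified \<Rightarrow> 'a complexified \<Rightarrow> complex" where
  "cform L \<zeta> \<xi> =
     Complex (form L (re_part \<zeta>) (re_part \<xi>) - form L (im_part \<zeta>) (im_part \<xi>))
             (form L (re_part \<zeta>) (im_part \<xi>) + form L (im_part \<zeta>) (re_part \<xi>))"


section \<open>The group algebra of the discriminant group and the theta function\<close>

text \<open>The space \<open>\<complex>[D\<^sub>L]\<close> consists of coefficient functions vanishing off \<open>disc L\<close>. As sets,
  \<open>disc (twist_neg L) = disc L\<close>, so the basis dual to \<open>basis_vec\<close> is \<open>basis_vec\<close> again.\<close>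

definition group_alg :: "('a::real_vector) lat \<Rightarrow> ('a set \<Rightarrow> complex) set" where
  "group_alg L = {U. \<forall>\<gamma>. \<gamma> \<notin> disc L \<longrightarrow> U \<gamma> = 0}"

definition basis_vec :: "'a set \<Rightarrow> 'a set \<Rightarrow> complex" where
  "basis_vec \<gamma> = (\<lambda>\<delta>. if \<delta> = \<gamma> then 1 else 0)"

definition pairing :: "('a::real_vector) lat \<Rightarrow> ('a set \<Rightarrow> complex) \<Rightarrow> ('a set \<Rightarrow> complex) \<Rightarrow> complex" where
  "pairing L U V = (\<Sum>\<gamma>\<in>disc L. U \<gamma> * V \<gamma>)"

definition upper_half :: "complex set" where
  "upper_half = {\<tau>. Im \<tau> > 0}"

definition ee :: "complex \<Rightarrow> complex" where
  "ee w = exp (2 * of_real pi * \<i> * w)"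

definition theta ::
  "('a::real_vector) lat \<Rightarrow> 'a set \<times> 'a set \<Rightarrow> complex \<Rightarrow> 'a complexified \<Rightarrow> 'a set \<Rightarrow> complex" where
  "theta L v \<tau> \<zeta> = (\<lambda>\<gamma>. if \<gamma> \<in> disc L then
     (\<Sum>\<^sub>\<infinity>x\<in>\<gamma>.
        let p = orth_proj L (fst v) x; m = orth_proj L (snd v) x in
        ee (\<tau> * of_real (form L p p / 2) + cnj \<tau> * of_real (form L m m / 2) + cform L (Cx x 0) \<zeta>))
     else 0)"


section \<open>The metaplectic group and the Weil representation\<close>

definition mob :: "real^2^2 \<Rightarrow> complex \<Rightarrow> complex" where
  "mob A \<tau> = (of_real (A$1$1) * \<tau> + of_real (A$1$2)) / (of_real (A$2$1) * \<tau> + of_real (A$2$2))"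

definition aut :: "real^2^2 \<Rightarrow> complex \<Rightarrow> complex" where
  "aut A \<tau> = of_real (A$2$1) * \<tau> + of_real (A$2$2)"

definition SL2Z :: "(real^2^2) set" where
  "SL2Z = {A. det A = 1 \<and> (\<forall>i j. A$i$j \<in> \<int>)}"

type_synonym metaplectic_pair = "(real^2^2) \<times> (complex \<Rightarrow> complex)"

text \<open>Functions on the upper half plane are made extensional, so that equality of elements of the
  metaplectic group is equality of pairs.\<close>

definition Mp2R :: "metaplectic_pair monoid" where
  "Mp2R = \<lparr>carrier = {(A, \<phi>). det A = 1 \<and> \<phi> \<in> extensional upper_half \<and>
                        \<phi> holomorphic_on upper_half \<and> (\<forall>\<tau>\<in>upper_half. \<phi> \<tau> ^ 2 = aut A \<tau>)},
           mult = \<lambda>(A, \<phi>) (B, \<psi>). (A ** B, restrict (\<lambda>\<tau>. \<phi> (mob B \<tau>) * \<psi> \<tau>) upper_half),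
           one = (mat 1, restrict (\<lambda>\<tau>. 1) upper_half)\<rparr>"

definition Mp2Z :: "metaplectic_pair monoid" where
  "Mp2Z = Mp2R\<lparr>carrier := {g \<in> carrier Mp2R. fst g \<in> SL2Z}\<rparr>"

definition mpT :: "metaplectic_pair" where
  "mpT = (vector [vector [1, 1], vector [0, 1]], restrict (\<lambda>\<tau>. 1) upper_half)"

text \<open>On the upper half plane, \<open>csqrt\<close> is the square root lying in the upper half plane.\<close>

definition mpS :: "metaplectic_pair" where
  "mpS = (vector [vector [0, -1], vector [1, 0]], restrict csqrt upper_half)"

text \<open>The pairing of two cosets is only defined modulo \<open>\<int>\<close>, and \<open>\<gamma>\<^sup>2\<close> only modulo \<open>2\<int>\<close>; both are
  only used inside \<open>ee\<close>, through representatives.\<close>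

definition rep :: "'a set \<Rightarrow> 'a" where
  "rep \<gamma> = (SOME x. x \<in> \<gamma>)"

definition is_weil_rep ::
  "('a::real_vector) lat \<Rightarrow>
   (metaplectic_pair \<Rightarrow> ('a set \<Rightarrow> complex) \<Rightarrow> ('a set \<Rightarrow> complex)) \<Rightarrow> bool" where
  "is_weil_rep L \<rho> \<longleftrightarrow>
     \<rho> \<in> extensional (carrier Mp2Z) \<and>
     group_action Mp2Z (group_alg L) \<rho> \<and>
     (\<forall>g\<in>carrier Mp2Z. \<forall>U\<in>group_alg L. \<forall>V\<in>group_alg L. \<forall>a b.
        \<rho> g (\<lambda>\<gamma>. a * U \<gamma> + b * V \<gamma>) = (\<lambda>\<gamma>. a * \<rho> g U \<gamma> + b * \<rho> g V \<gamma>)) \<and>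
     (\<forall>\<gamma>\<in>disc L. \<rho> mpT (basis_vec \<gamma>) =
        (\<lambda>\<delta>. ee (of_real (form L (rep \<gamma>) (rep \<gamma>) / 2)) * basis_vec \<gamma> \<delta>)) \<and>
     (\<forall>\<gamma>\<in>disc L. \<rho> mpS (basis_vec \<gamma>) =
        (\<lambda>\<epsilon>. ee (of_real ((real (sig_neg L) - real (sig_pos L)) / 8)) / of_real (sqrt (card (disc L))) *
              (\<Sum>\<delta>\<in>disc L. ee (of_real (- form L (rep \<gamma>) (rep \<delta>))) * basis_vec \<delta> \<epsilon>)))"

text \<open>The conditions determine the representation, because \<open>mpT\<close> and \<open>mpS\<close> generate \<open>Mp2Z\<close>.
  Its existence is Weil's theorem.\<close>

definition weil_rep ::
  "('a::real_vector) lat \<Rightarrow>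
   metaplectic_pair \<Rightarrow> ('a set \<Rightarrow> complex) \<Rightarrow> ('a set \<Rightarrow> complex)" where
  "weil_rep L = (THE \<rho>. is_weil_rep L \<rho>)"

definition dual_weil_rep ::
  "('a::real_vector) lat \<Rightarrow>
   metaplectic_pair \<Rightarrow> ('a set \<Rightarrow> complex) \<Rightarrow> ('a set \<Rightarrow> complex)" where
  "dual_weil_rep L = weil_rep (twist_neg L)"

definition finite_index_subgroup :: "'g set \<Rightarrow> ('g, 'm) monoid_scheme \<Rightarrow> bool" where
  "finite_index_subgroup \<Gamma> G \<longleftrightarrow> subgroup \<Gamma> G \<and> finite (rcosets\<^bsub>G\<^esub> \<Gamma>)"


section \<open>Modular forms\<close>

text \<open>Continuous differentiability of order \<open>n\<close> on an open set, over the reals.\<close>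

primrec Ck_on :: "nat \<Rightarrow> ('a::real_normed_vector \<Rightarrow> 'b::real_normed_vector) \<Rightarrow> 'a set \<Rightarrow> bool" where
  "Ck_on 0 f S \<longleftrightarrow> continuous_on S f"
| "Ck_on (Suc n) f S \<longleftrightarrow> (\<forall>x\<in>S. f differentiable (at x)) \<and>
     (\<forall>h. Ck_on n (\<lambda>x. frechet_derivative f (at x) h) S)"

definition smooth_on :: "('a::real_normed_vector \<Rightarrow> 'b::real_normed_vector) \<Rightarrow> 'a set \<Rightarrow> bool" where
  "smooth_on f S \<longleftrightarrow> (\<forall>n. Ck_on n f S)"

definition half_integers :: "real set" where
  "half_integers = {p. 2 * p \<in> \<int>}"

text \<open>Since \<open>disc L\<close> is finite, smoothness and growth of a function with values in \<open>\<complex>[D\<^sub>L]\<close> may be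
  tested on components.\<close>

definition lin_exp_growth :: "('a::real_vector) lat \<Rightarrow> (complex \<Rightarrow> 'a set \<Rightarrow> complex) \<Rightarrow> bool" where
  "lin_exp_growth L F \<longleftrightarrow>
     (\<forall>A\<in>SL2Z. \<exists>C::real. \<forall>X::real set. bounded X \<longrightarrow>
        (\<exists>M y0. \<forall>x\<in>X. \<forall>y>0. y \<ge> y0 \<longrightarrow>
           (\<forall>\<gamma>\<in>disc L. norm (F (mob A (Complex x y)) \<gamma>) \<le> M * exp (C * y))))"

definition modular_form ::
  "real \<Rightarrow> real \<Rightarrow> ('a::real_vector) lat \<Rightarrow> metaplectic_pair set \<Rightarrow>
   (complex \<Rightarrow> 'a set \<Rightarrow> complex) \<Rightarrow> bool" where
  "modular_form p q L \<Gamma> F \<longleftrightarrow>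
     p \<in> half_integers \<and> q \<in> half_integers \<and>
     (\<forall>\<tau>\<in>upper_half. F \<tau> \<in> group_alg (twist_neg L)) \<and>
     (\<forall>\<gamma>. smooth_on (\<lambda>\<tau>. F \<tau> \<gamma>) upper_half) \<and>
     (\<forall>(A, \<phi>)\<in>\<Gamma>. \<forall>\<tau>\<in>upper_half. F (mob A \<tau>) =
        (\<lambda>\<gamma>. \<phi> \<tau> powi \<lfloor>2 * p\<rfloor> * cnj (\<phi> \<tau>) powi \<lfloor>2 * q\<rfloor> * dual_weil_rep L (A, \<phi>) (F \<tau>) \<gamma>)) \<and>
     lin_exp_growth L F"

definition Phi ::
  "('a::real_vector) lat \<Rightarrow> 'a set \<times> 'a set \<Rightarrow> (complex \<Rightarrow> 'a set \<Rightarrow> complex) \<Rightarrow>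
   complex \<Rightarrow> 'a complexified \<Rightarrow> complex" where
  "Phi L v F \<tau> \<zeta> = pairing L (theta L v \<tau> \<zeta>) (F \<tau>)"


section \<open>Direct sums\<close>

definition dsum_lat :: "('a::real_vector) lat \<Rightarrow> ('b::real_vector) lat \<Rightarrow> ('a \<times> 'b) lat" where
  "dsum_lat L K = \<lparr>pts = pts L \<times> pts K,
                   form = \<lambda>x y. form L (fst x) (fst y) + form K (snd x) (snd y)\<rparr>"

definition dsum_gr :: "'a set \<times> 'a set \<Rightarrow> 'b set \<times> 'b set \<Rightarrow> ('a \<times> 'b) set \<times> ('a \<times> 'b) set" where
  "dsum_gr v w = (fst v \<times> fst w, snd v \<times> snd w)"

definition dsum_cx :: "'a complexified \<Rightarrow> 'b complexified \<Rightarrow> ('a \<times> 'b) complexified" where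
  "dsum_cx \<zeta> \<xi> = Cx (re_part \<zeta>, re_part \<xi>) (im_part \<zeta>, im_part \<xi>)"

text \<open>The element \<open>(\<gamma>, \<delta>)\<close> of the discriminant group of the direct sum is the coset \<open>\<gamma> \<times> \<delta>\<close>, whose
  two projections are \<open>\<gamma>\<close> and \<open>\<delta>\<close>.\<close>

definition tensor ::
  "('a::real_vector) lat \<Rightarrow> ('b::real_vector) lat \<Rightarrow>
   ('a set \<Rightarrow> complex) \<Rightarrow> ('b set \<Rightarrow> complex) \<Rightarrow> ('a \<times> 'b) set \<Rightarrow> complex" where
  "tensor L K U V = (\<lambda>\<epsilon>. if \<epsilon> \<in> disc (dsum_lat L K) then U (fst ` \<epsilon>) * V (snd ` \<epsilon>) else 0)"


subsection \<open>The conventions fit together\<close>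

lemma csqrt_upper_half:
  assumes "\<tau> \<in> upper_half" shows "csqrt \<tau> \<in> upper_half"
proof -
  have "Im \<tau> > 0" using assms by (simp add: upper_half_def)
  then have "cmod \<tau> > Re \<tau>"
    using abs_Re_le_cmod[of \<tau>] cmod_eq_Re[of \<tau>] cmod_Re_le_iff[of \<tau> "of_real (Re \<tau>)"]
    by (smt (verit) cmod_power2 power2_less_0 zero_less_power2)
  then show ?thesis using \<open>Im \<tau> > 0\<close> by (simp add: upper_half_def)
qed

lemma disc_twist_neg: "disc (twist_neg L) = disc L"
proof -
  have "dual_lattice (twist_neg L) = dual_lattice L"
    by (simp add: dual_lattice_def twist_neg_def realspan_def)
  then show ?thesis
    by (simp add: disc_def twist_neg_def)
qed

lemma zero_in_pts:
  fixes L :: "('a::real_vector) lat"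
  assumes "even_lattice L" shows "0 \<in> pts L"
proof -
  obtain B where B: "pts L = {\<Sum>b\<in>B. of_int (c b) *\<^sub>R b |c :: 'a \<Rightarrow> int. True}"
    using assms[unfolded even_lattice_def, THEN conjunct1] by (elim exE conjE)
  show ?thesis unfolding B by (intro CollectI exI[of _ "\<lambda>_. 0"]) simp
qed

lemma realspan_dsum:
  fixes L :: "('a::real_vector) lat" and K :: "('b::real_vector) lat"
  assumes "even_lattice L" "even_lattice K"
  shows "realspan (dsum_lat L K) = realspan L \<times> realspan K"
proof
  show "realspan (dsum_lat L K) \<subseteq> realspan L \<times> realspan K"
    unfolding realspan_def dsum_lat_def
    by (rule span_minimal) (auto intro: span_base subspace_Times subspace_span)
  have 1: "(x, 0) \<in> span (pts L \<times> pts K)" if "x \<in> span (pts L)" for x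
  proof -
    have l: "linear (\<lambda>x. (x, 0) :: 'a \<times> 'b)" by (intro linearI) auto
    have "(x, 0 :: 'b) \<in> (\<lambda>x. (x, 0)) ` span (pts L)" using that by blast
    also have "\<dots> = span ((\<lambda>x. (x, 0)) ` pts L)"
      using linear_span_image[OF l] by simp
    also have "\<dots> \<subseteq> span (pts L \<times> pts K)"
      by (rule span_mono) (auto intro: zero_in_pts assms)
    finally show ?thesis .
  qed
  have 2: "(0, y) \<in> span (pts L \<times> pts K)" if "y \<in> span (pts K)" for y
  proof -
    have l: "linear (\<lambda>y. (0, y) :: 'a \<times> 'b)" by (intro linearI) auto
    have "(0 :: 'a, y) \<in> (\<lambda>y. (0, y)) ` span (pts K)" using that by blast
    also have "\<dots> = span ((\<lambda>y. (0, y)) ` pts K)"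
      using linear_span_image[OF l] by simp
    also have "\<dots> \<subseteq> span (pts L \<times> pts K)"
      by (rule span_mono) (auto intro: zero_in_pts assms)
    finally show ?thesis .
  qed
  show "realspan L \<times> realspan K \<subseteq> realspan (dsum_lat L K)"
  proof
    fix z assume "z \<in> realspan L \<times> realspan K"
    then obtain x y where "z = (x, 0) + (0, y)" "x \<in> span (pts L)" "y \<in> span (pts K)"
      by (cases z) (auto simp: realspan_def)
    with 1 2 show "z \<in> realspan (dsum_lat L K)"
      by (simp only: realspan_def dsum_lat_def lat.simps span_add)
  qed
qed

lemma form_0:
  assumes "even_lattice L" shows "form L x 0 = 0" "form L 0 x = 0"
proof -
  have "bilinear (form L)" using assms by (simp add: even_lattice_def)
  then show "form L x 0 = 0" "form L 0 x = 0" by (simp_all add: bilinear_rzero bilinear_lzero)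
qed

lemma dual_lattice_dsum:
  assumes "even_lattice L" "even_lattice K"
  shows "dual_lattice (dsum_lat L K) = dual_lattice L \<times> dual_lattice K"
proof -
  have "(\<forall>y\<in>pts (dsum_lat L K). form (dsum_lat L K) x y \<in> \<int>) \<longleftrightarrow>
        (\<forall>y\<in>pts L. form L (fst x) y \<in> \<int>) \<and> (\<forall>y\<in>pts K. form K (snd x) y \<in> \<int>)" (is "?l \<longleftrightarrow> ?r") for x
  proof
    assume l: ?l
    show ?r
    proof safe
      fix y assume "y \<in> pts L"
      then show "form L (fst x) y \<in> \<int>"
        using l[rule_format, of "(y, 0)"] zero_in_pts[OF assms(2)]
        by (simp add: dsum_lat_def form_0[OF assms(2)])
    next
      fix y assume "y \<in> pts K"
      then show "form K (snd x) y \<in> \<int>"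
        using l[rule_format, of "(0, y)"] zero_in_pts[OF assms(1)]
        by (simp add: dsum_lat_def form_0[OF assms(1)])
    qed
  next
    assume ?r then show ?l by (auto simp: dsum_lat_def)
  qed
  then show ?thesis
    unfolding dual_lattice_def realspan_dsum[OF assms] by auto
qed

lemma disc_iff:
  "\<gamma> \<in> disc L \<longleftrightarrow> (\<exists>x\<in>dual_lattice L. \<gamma> = {y \<in> dual_lattice L. x - y \<in> pts L})"
  by (auto simp: disc_def quotient_def)

lemma disc_nonempty:
  assumes "even_lattice L" "\<gamma> \<in> disc L" shows "\<gamma> \<noteq> {}"
  using assms zero_in_pts[OF assms(1)] by (auto simp: disc_iff)

lemma disc_dsum:
  assumes "even_lattice L" "even_lattice K"
  shows "disc (dsum_lat L K) = (\<lambda>(\<gamma>, \<delta>). \<gamma> \<times> \<delta>) ` (disc L \<times> disc K)"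
proof -
  have "{z \<in> dual_lattice L \<times> dual_lattice K. (x, y) - z \<in> pts (dsum_lat L K)} =
      {z \<in> dual_lattice L. x - z \<in> pts L} \<times> {z \<in> dual_lattice K. y - z \<in> pts K}" for x y
    by (auto simp: dsum_lat_def)
  then have iff: "\<epsilon> \<in> disc (dsum_lat L K) \<longleftrightarrow> (\<exists>x\<in>dual_lattice L. \<exists>y\<in>dual_lattice K.
      \<epsilon> = {z \<in> dual_lattice L. x - z \<in> pts L} \<times> {z \<in> dual_lattice K. y - z \<in> pts K})" for \<epsilon>
    unfolding disc_iff dual_lattice_dsum[OF assms] by auto
  show ?thesis
  proof (intro Set.set_eqI iffI)
    fix \<epsilon> assume "\<epsilon> \<in> disc (dsum_lat L K)"
    then obtain x y where xy: "x \<in> dual_lattice L" "y \<in> dual_lattice K"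
      and \<epsilon>: "\<epsilon> = {z \<in> dual_lattice L. x - z \<in> pts L} \<times> {z \<in> dual_lattice K. y - z \<in> pts K}"
      using iff[of \<epsilon>] by (metis (no_types, lifting))
    have "{z \<in> dual_lattice L. x - z \<in> pts L} \<in> disc L" "{z \<in> dual_lattice K. y - z \<in> pts K} \<in> disc K"
      using xy disc_iff by (metis (mono_tags, lifting))+
    then show "\<epsilon> \<in> (\<lambda>(\<gamma>, \<delta>). \<gamma> \<times> \<delta>) ` (disc L \<times> disc K)"
      unfolding \<epsilon> by (intro image_eqI[of _ _ "(_, _)"]) auto
  next
    fix \<epsilon> assume "\<epsilon> \<in> (\<lambda>(\<gamma>, \<delta>). \<gamma> \<times> \<delta>) ` (disc L \<times> disc K)"
    then obtain \<gamma> \<delta> where "\<epsilon> = \<gamma> \<times> \<delta>" and \<gamma>: "\<gamma> \<in> disc L" and \<delta>: "\<delta> \<in> disc K" by auto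
    moreover obtain x where "x \<in> dual_lattice L" "\<gamma> = {z \<in> dual_lattice L. x - z \<in> pts L}"
      using \<gamma>[unfolded disc_iff] by (elim bexE)
    moreover obtain y where "y \<in> dual_lattice K" "\<delta> = {z \<in> dual_lattice K. y - z \<in> pts K}"
      using \<delta>[unfolded disc_iff] by (elim bexE)
    ultimately show "\<epsilon> \<in> disc (dsum_lat L K)"
      by (intro iffD2[OF iff]) (rule bexI, rule bexI, simp_all only:)
  qed
qed

lemma tensor_basis_vec:
  assumes "even_lattice L" "even_lattice K" "\<gamma> \<in> disc L" "\<delta> \<in> disc K"
  shows "tensor L K (basis_vec \<gamma>) (basis_vec \<delta>) = basis_vec (\<gamma> \<times> \<delta>)"
proof
  fix \<epsilon>
  show "tensor L K (basis_vec \<gamma>) (basis_vec \<delta>) \<epsilon> = basis_vec (\<gamma> \<times> \<delta>) \<epsilon>"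
  proof (cases "\<epsilon> \<in> disc (dsum_lat L K)")
    case True
    then obtain \<gamma>' \<delta>' where \<epsilon>: "\<epsilon> = \<gamma>' \<times> \<delta>'" "\<gamma>' \<in> disc L" "\<delta>' \<in> disc K"
      by (auto simp: disc_dsum[OF assms(1,2)])
    moreover have "fst ` \<epsilon> = \<gamma>'" "snd ` \<epsilon> = \<delta>'"
      using \<epsilon> disc_nonempty assms by auto
    ultimately show ?thesis
      using True disc_nonempty[OF assms(1)] disc_nonempty[OF assms(2)] assms(3,4)
      by (auto simp: tensor_def basis_vec_def times_eq_iff)
  next
    case False
    then have "\<epsilon> \<noteq> \<gamma> \<times> \<delta>" using assms by (auto simp: disc_dsum)
    with False show ?thesis by (simp add: tensor_def basis_vec_def)
  qed
qed

lemma independent_dsum: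
  fixes B :: "'a::real_vector set" and C :: "'b::real_vector set"
  assumes "finite B" "finite C" "independent B" "independent C"
  shows "independent ((\<lambda>b. (b, 0)) ` B \<union> (\<lambda>c. (0, c)) ` C)"
    and "(\<Sum>z\<in>(\<lambda>b. (b, 0)) ` B \<union> (\<lambda>c. (0, c)) ` C. f z *\<^sub>R z) =
          ((\<Sum>b\<in>B. f (b, 0) *\<^sub>R b), (\<Sum>c\<in>C. f (0, c) *\<^sub>R c))"
proof -
  have n0: "0 \<notin> B" "0 \<notin> C" using assms dependent_zero by auto
  show sum: "(\<Sum>z\<in>(\<lambda>b. (b, 0)) ` B \<union> (\<lambda>c. (0, c)) ` C. f z *\<^sub>R z) =
          ((\<Sum>b\<in>B. f (b, 0) *\<^sub>R b), (\<Sum>c\<in>C. f (0, c) *\<^sub>R c))" for f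
  proof -
    have "(\<Sum>z\<in>(\<lambda>b. (b, 0)) ` B \<union> (\<lambda>c. (0, c)) ` C. f z *\<^sub>R z) =
        (\<Sum>z\<in>(\<lambda>b. (b, 0)) ` B. f z *\<^sub>R z) + (\<Sum>z\<in>(\<lambda>c. (0, c)) ` C. f z *\<^sub>R z)"
      by (rule sum.union_disjoint) (use assms n0 in auto)
    also have "\<dots> = (\<Sum>b\<in>B. f (b, 0) *\<^sub>R (b, 0)) + (\<Sum>c\<in>C. f (0, c) *\<^sub>R (0, c))"
      by (simp add: sum.reindex inj_on_def)
    also have "\<dots> = ((\<Sum>b\<in>B. f (b, 0) *\<^sub>R b), (\<Sum>c\<in>C. f (0, c) *\<^sub>R c))"
      by (simp add: prod_eq_iff fst_sum snd_sum)
    finally show ?thesis .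
  qed
  show "independent ((\<lambda>b. (b, 0)) ` B \<union> (\<lambda>c. (0, c)) ` C)"
  proof (rule independent_if_scalars_zero)
    fix f :: "'a \<times> 'b \<Rightarrow> real" and z
    assume s: "(\<Sum>z\<in>(\<lambda>b. (b, 0)) ` B \<union> (\<lambda>c. (0, c)) ` C. f z *\<^sub>R z) = 0"
      and z: "z \<in> (\<lambda>b. (b, 0)) ` B \<union> (\<lambda>c. (0, c)) ` C"
    from s have s': "(\<Sum>b\<in>B. f (b, 0) *\<^sub>R b) = 0" "(\<Sum>c\<in>C. f (0, c) *\<^sub>R c) = 0"
      unfolding sum by (auto simp: zero_prod_def)
    have "f (b, 0) = 0" if "b \<in> B" for b
      using independentD[OF assms(3,1) order_refl s'(1) that] .
    moreover have "f (0, c) = 0" if "c \<in> C" for c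
      using independentD[OF assms(4,2) order_refl s'(2) that] .
    ultimately show "f z = 0" using z by auto
  qed (use assms in auto)
qed

lemma even_lattice_dsum:
  fixes L :: "('a::real_vector) lat" and K :: "('b::real_vector) lat"
  assumes "even_lattice L" "even_lattice K"
  shows "even_lattice (dsum_lat L K)"
  unfolding even_lattice_def
proof (intro conjI)
  obtain B where B: "finite B" "independent B"
    "pts L = {\<Sum>b\<in>B. of_int (c b) *\<^sub>R b |c :: 'a \<Rightarrow> int. True}"
    using assms(1)[unfolded even_lattice_def, THEN conjunct1] by (elim exE conjE)
  obtain C where C: "finite C" "independent C"
    "pts K = {\<Sum>b\<in>C. of_int (c b) *\<^sub>R b |c :: 'b \<Rightarrow> int. True}"
    using assms(2)[unfolded even_lattice_def, THEN conjunct1] by (elim exE conjE)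
  let ?D = "(\<lambda>b. (b, 0)) ` B \<union> (\<lambda>c. (0, c)) ` C"
  have n0: "0 \<notin> B" "0 \<notin> C" using B C dependent_zero by auto
  have "pts (dsum_lat L K) = {\<Sum>b\<in>?D. of_int (c b) *\<^sub>R b |c :: 'a \<times> 'b \<Rightarrow> int. True}" (is "?l = ?r")
  proof
    show "?r \<subseteq> ?l"
      unfolding independent_dsum(2)[OF B(1) C(1) B(2) C(2)] dsum_lat_def B(3) C(3) by auto
    show "?l \<subseteq> ?r"
    proof
      fix z assume "z \<in> ?l"
      then obtain c d where z: "z = ((\<Sum>b\<in>B. of_int (c b) *\<^sub>R b), (\<Sum>b\<in>C. of_int (d b) *\<^sub>R b))"
        by (cases z) (auto simp: dsum_lat_def B(3) C(3))
      let ?f = "\<lambda>(x, y). if y = 0 then c x else d y"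
      have "z = (\<Sum>b\<in>?D. of_int (?f b) *\<^sub>R b)"
        unfolding independent_dsum(2)[OF B(1) C(1) B(2) C(2)] z
        using n0 by (auto intro!: sum.cong)
      then show "z \<in> ?r" by blast
    qed
  qed
  then show "\<exists>B. finite B \<and> independent B \<and>
      pts (dsum_lat L K) = {\<Sum>b\<in>B. of_int (c b) *\<^sub>R b |c :: 'a \<times> 'b \<Rightarrow> int. True}"
    using independent_dsum(1)[OF B(1) C(1) B(2) C(2)] B(1) C(1) by (intro exI[of _ ?D]) auto
  have bl: "bilinear (form L)" "bilinear (form K)"
    using assms by (auto simp: even_lattice_def)
  show "bilinear (form (dsum_lat L K))"
    unfolding bilinear_def dsum_lat_def
    using bl by (auto intro!: linearI simp: bilinear_ladd bilinear_radd bilinear_lmul bilinear_rmul algebra_simps)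
  show "\<forall>x\<in>pts (dsum_lat L K). \<forall>y\<in>pts (dsum_lat L K). form (dsum_lat L K) x y = form (dsum_lat L K) y x"
    "\<forall>x\<in>pts (dsum_lat L K). \<forall>y\<in>pts (dsum_lat L K). form (dsum_lat L K) x y \<in> \<int>"
    using assms by (auto simp: dsum_lat_def even_lattice_def)
  show "\<forall>x\<in>pts (dsum_lat L K). (\<forall>y\<in>pts (dsum_lat L K). form (dsum_lat L K) x y = 0) \<longrightarrow> x = 0"
  proof (intro ballI impI)
    fix x assume x: "x \<in> pts (dsum_lat L K)" "\<forall>y\<in>pts (dsum_lat L K). form (dsum_lat L K) x y = 0"
    have "form L (fst x) y = 0" if "y \<in> pts L" for y
      using x(2)[rule_format, of "(y, 0)"] that zero_in_pts[OF assms(2)]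
      by (simp add: dsum_lat_def form_0[OF assms(2)])
    moreover have "form K (snd x) y = 0" if "y \<in> pts K" for y
      using x(2)[rule_format, of "(0, y)"] that zero_in_pts[OF assms(1)]
      by (simp add: dsum_lat_def form_0[OF assms(1)])
    ultimately show "x = 0"
      using assms x(1) by (auto simp: dsum_lat_def even_lattice_def prod_eq_iff)
  qed
  show "\<forall>x\<in>pts (dsum_lat L K). \<exists>m::int. form (dsum_lat L K) x x = 2 * of_int m"
  proof
    fix x assume "x \<in> pts (dsum_lat L K)"
    then obtain m n :: int where "form L (fst x) (fst x) = 2 * of_int m" "form K (snd x) (snd x) = 2 * of_int n"
      using assms by (fastforce simp: dsum_lat_def even_lattice_def)
    then show "\<exists>m::int. form (dsum_lat L K) x x = 2 * of_int m"
      by (intro exI[of _ "m + n"]) (simp add: dsum_lat_def)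
  qed
qed

lemma dsum_gr_in_Gr:
  assumes "even_lattice L" "even_lattice K" "v \<in> Gr L" "w \<in> Gr K"
  shows "dsum_gr v w \<in> Gr (dsum_lat L K)"
proof -
  obtain vp vm where v: "v = (vp, vm)" by (cases v)
  obtain wp wm where w: "w = (wp, wm)" by (cases w)
  note V = assms(3)[unfolded v Gr_def, simplified]
  note W = assms(4)[unfolded w Gr_def, simplified]
  have P: "pos_definite_on (dsum_lat L K) (vp \<times> wp)"
    unfolding pos_definite_on_def
  proof (intro ballI impI)
    fix x assume x: "x \<in> vp \<times> wp" "x \<noteq> 0"
    have "fst x \<noteq> 0 \<or> snd x \<noteq> 0" using x(2) by (simp add: prod_eq_iff)
    moreover have "fst x \<noteq> 0 \<Longrightarrow> form L (fst x) (fst x) > 0" "snd x \<noteq> 0 \<Longrightarrow> form K (snd x) (snd x) > 0"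
      using x(1) V W by (auto simp: pos_definite_on_def mem_Times_iff)
    ultimately show "form (dsum_lat L K) x x > 0"
      using form_0[OF assms(1), of 0] form_0[OF assms(2), of 0]
      by (cases "fst x = 0"; cases "snd x = 0") (auto simp: dsum_lat_def)
  qed
  have N: "neg_definite_on (dsum_lat L K) (vm \<times> wm)"
    unfolding neg_definite_on_def
  proof (intro ballI impI)
    fix x assume x: "x \<in> vm \<times> wm" "x \<noteq> 0"
    have "fst x \<noteq> 0 \<or> snd x \<noteq> 0" using x(2) by (simp add: prod_eq_iff)
    moreover have "fst x \<noteq> 0 \<Longrightarrow> form L (fst x) (fst x) < 0" "snd x \<noteq> 0 \<Longrightarrow> form K (snd x) (snd x) < 0"
      using x(1) V W by (auto simp: neg_definite_on_def mem_Times_iff)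
    ultimately show "form (dsum_lat L K) x x < 0"
      using form_0[OF assms(1), of 0] form_0[OF assms(2), of 0]
      by (cases "fst x = 0"; cases "snd x = 0") (auto simp: dsum_lat_def)
  qed
  have rL: "realspan L = {x + y |x y. x \<in> vp \<and> y \<in> vm}" using V by blast
  have rK: "realspan K = {x + y |x y. x \<in> wp \<and> y \<in> wm}" using W by blast
  have S: "realspan L \<times> realspan K = {x + y |x y. x \<in> vp \<times> wp \<and> y \<in> vm \<times> wm}"
  proof (intro Set.set_eqI iffI)
    fix z assume "z \<in> realspan L \<times> realspan K"
    then obtain a b c d where "z = (a + b, c + d)" "a \<in> vp" "b \<in> vm" "c \<in> wp" "d \<in> wm"
      unfolding rL rK by auto
    then have "z = (a, c) + (b, d)" "(a, c) \<in> vp \<times> wp" "(b, d) \<in> vm \<times> wm" by auto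
    then show "z \<in> {x + y |x y. x \<in> vp \<times> wp \<and> y \<in> vm \<times> wm}" by blast
  next
    fix z assume "z \<in> {x + y |x y. x \<in> vp \<times> wp \<and> y \<in> vm \<times> wm}"
    then show "z \<in> realspan L \<times> realspan K" unfolding rL rK by auto
  qed
  have O: "form (dsum_lat L K) x y = 0" if "x \<in> vp \<times> wp" "y \<in> vm \<times> wm" for x y
    using V W that by (auto simp: dsum_lat_def)
  have "subspace (vp \<times> wp)" "subspace (vm \<times> wm)"
    using V W by (auto intro: subspace_Times)
  then show ?thesis
    unfolding Gr_def dsum_gr_def realspan_dsum[OF assms(1,2)] v w fst_conv snd_conv mem_Collect_eq prod.case
    by (intro conjI ballI P N S O)
qed

end

theory Submission
  imports Defs
begin

text \<open>Orthogonal projections, the bilinear pairing and the cosets of a direct sum are all computed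
  componentwise, so each summand of the theta series of \<open>L \<oplus> K\<close> is the product of a summand for
  \<open>L\<close> and one for \<open>K\<close>. Complex series over a product index set factor unconditionally: if the
  product family is not summable, then one of the two families diverges, and both sides are \<open>0\<close>
  because a divergent \<open>infsum\<close> is. Similarly \<open>sum\<close> over an infinite set is \<open>0\<close>.
  Hence neither the convergence of the theta series nor the finiteness of the discriminant
  group enters.\<close>

lemma infsum_times_complex:
  fixes f :: "'a \<Rightarrow> complex" and g :: "'b \<Rightarrow> complex"
  shows "(\<Sum>\<^sub>\<infinity>(x, y)\<in>A \<times> B. f x * g y) = infsum f A * infsum g B"
proof (cases "(\<lambda>(x, y). f x * g y) summable_on A \<times> B")
  case True
  \<comment> \<open>Fubini for a summable family gives an iterated sum; constant complex factors
    then come out of both sums.\<close>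
  then show ?thesis
    by (simp flip: infsum_Sigma'_banach add: infsum_cmult_right' infsum_cmult_left')
next
  case False
  have "\<not> (f summable_on A \<and> g summable_on B)"
  proof
    assume "f summable_on A \<and> g summable_on B"
    \<comment> \<open>Summability in \<complex> is absolute, and absolute summability passes to the
      product family: for fixed \<open>x\<close> the norms sum to \<open>norm (f x)\<close> times a
      constant.\<close>
    then have abs: "(\<lambda>x. norm (f x)) summable_on A" "(\<lambda>y. norm (g y)) summable_on B"
      by (simp_all add: summable_on_iff_abs_summable_on_complex)
    have "(\<lambda>z. norm (case z of (x, y) \<Rightarrow> f x * g y)) summable_on A \<times> B"
      unfolding Infinite_Sum.abs_summable_on_Sigma_iff
      using abs by (auto simp: norm_mult infsum_cmult_right' infsum_nonneg
          intro!: summable_on_cmult_right summable_on_cmult_left)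
    with False show False by (blast dest: abs_summable_summable)
  qed
  with False show ?thesis by (auto simp: infsum_not_exists)
qed

lemma sum_Times_mult:
  fixes f :: "'a \<Rightarrow> 'c::semiring_0"
  shows "(\<Sum>(x, y)\<in>A \<times> B. f x * g y) = sum f A * sum g B"
proof (cases "finite A \<and> finite B")
  case True
  then show ?thesis by (simp add: sum_product sum.cartesian_product)
next
  case False
  \<comment> \<open>An empty factor makes both sides zero. Otherwise the product set is infinite
    along with one factor, and both sides take the default value 0.\<close>
  then show ?thesis by (cases "A = {} \<or> B = {}") (auto simp: finite_cartesian_product_iff)
qed

text \<open>The form and its transpose are bilinear and agree on the lattice points, hence on their
  span.\<close>

lemma form_sym_realspan:
  assumes "even_lattice L" "x \<in> realspan L" "y \<in> realspan L"
  shows "form L x y = form L y x"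
proof -
  have bl: "bilinear (form L)" and sym: "\<And>x y. x \<in> pts L \<Longrightarrow> y \<in> pts L \<Longrightarrow> form L x y = form L y x"
    using assms(1) by (auto simp: even_lattice_def)
  have "bilinear (\<lambda>x y. form L y x)" using bl by (simp add: bilinear_def)
  with bl show ?thesis
    by (rule bilinear_eq[OF _ _ order_refl order_refl])
      (use assms sym in \<open>auto simp: realspan_def\<close>)
qed

text \<open>Uniqueness, which resolves the \<open>THE\<close>: the difference of two candidates lies
  in \<open>W\<close> and is orthogonal to \<open>W\<close>, so it is isotropic, and definiteness
  forces it to vanish.\<close>

lemma orth_proj_eqI:
  assumes "even_lattice L" "subspace W" "pos_definite_on L W \<or> neg_definite_on L W"
    and p: "p \<in> W" "\<And>w. w \<in> W \<Longrightarrow> form L (x - p) w = 0"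
  shows "orth_proj L W x = p"
  unfolding orth_proj_def
proof (rule the_equality)
  fix q assume q: "q \<in> W \<and> (\<forall>w\<in>W. form L (x - q) w = 0)"
  have "bilinear (form L)" using assms(1) by (simp add: even_lattice_def)
  then have "form L ((x - p) - (x - q)) (q - p) = form L (x - p) (q - p) - form L (x - q) (q - p)"
    by (rule bilinear_lsub)
  moreover have d: "q - p \<in> W" using q p assms(2) by (simp add: subspace_diff)
  ultimately have "form L (q - p) (q - p) = 0" using q p(2) by simp
  with d assms(3) have "q - p = 0"
    unfolding pos_definite_on_def neg_definite_on_def by (metis less_irrefl)
  then show "q = p" by simp
qed (use p in auto)

lemma Gr_definite:
  assumes "v \<in> Gr L" "W = fst v \<or> W = snd v"
  shows "subspace W" "pos_definite_on L W \<or> neg_definite_on L W"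
  using assms by (auto simp: Gr_def)

text \<open>Existence: the two components of \<open>x\<close> in the decomposition are its
  projections, since each residual is the other component.\<close>

lemma orth_proj_Gr:
  assumes "even_lattice L" "v \<in> Gr L" "x \<in> realspan L" "W = fst v \<or> W = snd v"
  shows "orth_proj L W x \<in> W" "w \<in> W \<Longrightarrow> form L (x - orth_proj L W x) w = 0"
proof -
  obtain vp vm where v: "v = (vp, vm)" by (cases v)
  have sub: "subspace vp" "subspace vm" and rs: "realspan L = {x + y |x y. x \<in> vp \<and> y \<in> vm}"
    and orth: "\<And>x y. x \<in> vp \<Longrightarrow> y \<in> vm \<Longrightarrow> form L x y = 0"
    using assms(2) by (auto simp: v Gr_def)
  \<comment> \<open>\<open>Gr\<close> puts the positive part on the left. Projecting onto that part
    leaves a negative residual on the left, which calls for the swapped order.\<close>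
  have orth': "form L y x = 0" if "x \<in> vp" "y \<in> vm" for x y
  proof -
    have "x + 0 \<in> realspan L" "0 + y \<in> realspan L"
      unfolding rs using that subspace_0[OF sub(1)] subspace_0[OF sub(2)] by blast+
    then show ?thesis using orth[OF that] form_sym_realspan[OF assms(1), of x y] by simp
  qed
  obtain a b where ab: "x = a + b" "a \<in> vp" "b \<in> vm"
    using assms(3) unfolding rs by blast
  then have "\<exists>p\<in>W. \<forall>w\<in>W. form L (x - p) w = 0"
    using assms(4)
  proof (elim disjE)
    assume "W = fst v"
    then show ?thesis using ab orth' by (intro bexI[of _ a]) (auto simp: v)
  next
    assume "W = snd v"
    then show ?thesis using ab orth by (intro bexI[of _ b]) (auto simp: v)
  qed
  then obtain p where p: "p \<in> W" "\<And>w. w \<in> W \<Longrightarrow> form L (x - p) w = 0" by blast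
  have "orth_proj L W x = p"
    using assms(1) Gr_definite[OF assms(2,4)] p by (rule orth_proj_eqI)
  then show "orth_proj L W x \<in> W" "w \<in> W \<Longrightarrow> form L (x - orth_proj L W x) w = 0"
    using p by simp_all
qed

text \<open>\<open>V\<close> and \<open>W\<close> have equal sign, so \<open>V \<times> W\<close> is
  a definite component of \<open>dsum_gr v w\<close> and uniqueness applies to the pair of
  projections.\<close>

lemma orth_proj_dsum:
  assumes LK: "even_lattice L" "even_lattice K" and vw: "v \<in> Gr L" "w \<in> Gr K"
    and x: "x \<in> realspan L" and y: "y \<in> realspan K"
    and VW: "V = fst v \<and> W = fst w \<or> V = snd v \<and> W = snd w"
  shows "orth_proj (dsum_lat L K) (V \<times> W) (x, y) = (orth_proj L V x, orth_proj K W y)"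
proof (rule orth_proj_eqI[OF even_lattice_dsum[OF LK]])
  have "V \<times> W = fst (dsum_gr v w) \<or> V \<times> W = snd (dsum_gr v w)"
    using VW by (auto simp: dsum_gr_def)
  note D = Gr_definite[OF dsum_gr_in_Gr[OF LK vw] this]
  show "subspace (V \<times> W)"
    "pos_definite_on (dsum_lat L K) (V \<times> W) \<or> neg_definite_on (dsum_lat L K) (V \<times> W)"
    using D by blast+
  have "V = fst v \<or> V = snd v" "W = fst w \<or> W = snd w" using VW by auto
  note P = orth_proj_Gr[OF LK(1) vw(1) x this(1)] orth_proj_Gr[OF LK(2) vw(2) y this(2)]
  show "(orth_proj L V x, orth_proj K W y) \<in> V \<times> W" using P by blast
  fix z assume "z \<in> V \<times> W"
  then show "form (dsum_lat L K) ((x, y) - (orth_proj L V x, orth_proj K W y)) z = 0"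
    using P by (auto simp: dsum_lat_def)
qed

lemma cform_dsum:
  "cform (dsum_lat L K) (dsum_cx \<zeta> \<xi>) (dsum_cx \<zeta>' \<xi>') = cform L \<zeta> \<zeta>' + cform K \<xi> \<xi>'"
  by (simp add: cform_def dsum_cx_def dsum_lat_def complex_eq_iff)

lemma ee_add: "ee (z + z') = ee z * ee z'"
  by (simp add: ee_def ring_distribs exp_add)

lemma disc_subset_realspan: "\<gamma> \<in> disc L \<Longrightarrow> \<gamma> \<subseteq> realspan L"
  by (auto simp: disc_iff dual_lattice_def)

definition theta_term ::
  "('a::real_vector) lat \<Rightarrow> 'a set \<times> 'a set \<Rightarrow> complex \<Rightarrow> 'a complexified \<Rightarrow> 'a \<Rightarrow> complex" where
  "theta_term L v \<tau> \<zeta> x =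
    (let p = orth_proj L (fst v) x; m = orth_proj L (snd v) x in
      ee (\<tau> * of_real (form L p p / 2) + cnj \<tau> * of_real (form L m m / 2) + cform L (Cx x 0) \<zeta>))"

lemma theta_eq: "\<gamma> \<in> disc L \<Longrightarrow> theta L v \<tau> \<zeta> \<gamma> = infsum (theta_term L v \<tau> \<zeta>) \<gamma>"
  by (simp add: theta_def theta_term_def[abs_def])

lemma theta_term_dsum:
  assumes "even_lattice L" "even_lattice K" "v \<in> Gr L" "w \<in> Gr K"
    and "x \<in> realspan L" "y \<in> realspan K"
  shows "theta_term (dsum_lat L K) (dsum_gr v w) \<tau> (dsum_cx \<zeta> \<xi>) (x, y) =
    theta_term L v \<tau> \<zeta> x * theta_term K w \<tau> \<xi> y"
proof -
  have "Cx (x, y) 0 = dsum_cx (Cx x 0) (Cx y 0)"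
    by (simp add: dsum_cx_def zero_prod_def)
  then have c: "cform (dsum_lat L K) (Cx (x, y) 0) (dsum_cx \<zeta> \<xi>) = cform L (Cx x 0) \<zeta> + cform K (Cx y 0) \<xi>"
    by (simp add: cform_dsum)
  have f: "form (dsum_lat L K) (a, b) (a, b) = form L a a + form K b b" for a b
    by (simp add: dsum_lat_def)
  show ?thesis
    \<comment> \<open>Read backwards, \<open>ee_add\<close> merges the right-hand product into one
      exponential, so only exponents remain to be compared.\<close>
    unfolding theta_term_def Let_def ee_add[symmetric] c
    using orth_proj_dsum[OF assms, of "fst v" "fst w"] orth_proj_dsum[OF assms, of "snd v" "snd w"]
    by (simp add: dsum_gr_def f algebra_simps add_divide_distrib)
qed

lemma theta_dsum:
  assumes "even_lattice L" "even_lattice K" "v \<in> Gr L" "w \<in> Gr K"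
    and "\<gamma> \<in> disc L" "\<delta> \<in> disc K"
  shows "theta (dsum_lat L K) (dsum_gr v w) \<tau> (dsum_cx \<zeta> \<xi>) (\<gamma> \<times> \<delta>) =
    theta L v \<tau> \<zeta> \<gamma> * theta K w \<tau> \<xi> \<delta>"
proof -
  have "\<gamma> \<times> \<delta> \<in> disc (dsum_lat L K)" using assms by (auto simp: disc_dsum)
  then have "theta (dsum_lat L K) (dsum_gr v w) \<tau> (dsum_cx \<zeta> \<xi>) (\<gamma> \<times> \<delta>) =
      infsum (theta_term (dsum_lat L K) (dsum_gr v w) \<tau> (dsum_cx \<zeta> \<xi>)) (\<gamma> \<times> \<delta>)"
    by (rule theta_eq)
  also have "\<dots> = (\<Sum>\<^sub>\<infinity>(x, y)\<in>\<gamma> \<times> \<delta>. theta_term L v \<tau> \<zeta> x * theta_term K w \<tau> \<xi> y)"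
    \<comment> \<open>Cosets lie in the real span, where \<open>theta_term_dsum\<close>
      applies.\<close>
    using disc_subset_realspan[OF assms(5)] disc_subset_realspan[OF assms(6)]
    by (intro infsum_cong) (auto simp: theta_term_dsum assms(1-4) subset_iff)
  also have "\<dots> = theta L v \<tau> \<zeta> \<gamma> * theta K w \<tau> \<xi> \<delta>"
    by (simp add: infsum_times_complex theta_eq assms)
  finally show ?thesis .
qed

text \<open>Product cosets exhaust the discriminant group of the sum, so reindexing by pairs of
  cosets gives a double sum that factors.\<close>

lemma pairing_dsum:
  assumes "even_lattice L" "even_lattice K"
    and U: "\<And>\<gamma> \<delta>. \<gamma> \<in> disc L \<Longrightarrow> \<delta> \<in> disc K \<Longrightarrow> U (\<gamma> \<times> \<delta>) = U\<^sub>1 \<gamma> * U\<^sub>2 \<delta>"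
  shows "pairing (dsum_lat L K) U (tensor L K V\<^sub>1 V\<^sub>2) = pairing L U\<^sub>1 V\<^sub>1 * pairing K U\<^sub>2 V\<^sub>2"
proof -
  \<comment> \<open>A product of nonempty sets determines its factors. Nonemptiness also lets
    \<open>tensor\<close> recover them as projections in the next step.\<close>
  have inj: "inj_on (\<lambda>(\<gamma>, \<delta>). \<gamma> \<times> \<delta>) (disc L \<times> disc K)"
    using assms by (auto simp: inj_on_def times_eq_iff dest: disc_nonempty)
  have "tensor L K V\<^sub>1 V\<^sub>2 (\<gamma> \<times> \<delta>) = V\<^sub>1 \<gamma> * V\<^sub>2 \<delta>" if "\<gamma> \<in> disc L" "\<delta> \<in> disc K" for \<gamma> \<delta>
    using that assms disc_nonempty[of L \<gamma>] disc_nonempty[of K \<delta>] by (auto simp: tensor_def disc_dsum)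
  then have "pairing (dsum_lat L K) U (tensor L K V\<^sub>1 V\<^sub>2) =
      (\<Sum>(\<gamma>, \<delta>)\<in>disc L \<times> disc K. (U\<^sub>1 \<gamma> * V\<^sub>1 \<gamma>) * (U\<^sub>2 \<delta> * V\<^sub>2 \<delta>))"
    unfolding pairing_def disc_dsum[OF assms(1,2)] sum.reindex[OF inj]
    by (intro sum.cong) (auto simp: U)
  then show ?thesis by (simp only: sum_Times_mult pairing_def)
qed

theorem proposition3p5:
  fixes L :: "('a::real_vector) lat" and K :: "('b::real_vector) lat"
    and v :: "'a set \<times> 'a set" and w :: "'b set \<times> 'b set"
    and \<Gamma> :: "metaplectic_pair set"
    and F :: "complex \<Rightarrow> 'a set \<Rightarrow> complex" and H :: "complex \<Rightarrow> 'b set \<Rightarrow> complex"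
    and k l \<kappa> \<mu> :: real
    and \<tau> :: complex and \<zeta> :: "'a complexified" and \<xi> :: "'b complexified"
  assumes "even_lattice L" and "even_lattice K"
    and "v \<in> Gr L" and "w \<in> Gr K"
    and "finite_index_subgroup \<Gamma> Mp2Z"
    and "k \<in> half_integers" and "l \<in> half_integers"
    and "\<kappa> \<in> half_integers" and "\<mu> \<in> half_integers"
    and "modular_form k l L \<Gamma> F"
    and "modular_form \<kappa> \<mu> K \<Gamma> H"
    and "\<tau> \<in> upper_half" and "\<zeta> \<in> cspan L" and "\<xi> \<in> cspan K"
  shows "Phi (dsum_lat L K) (dsum_gr v w) (\<lambda>\<sigma>. tensor L K (F \<sigma>) (H \<sigma>)) \<tau> (dsum_cx \<zeta> \<xi>) =
         Phi L v F \<tau> \<zeta> * Phi K w H \<tau> \<xi>"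
  unfolding Phi_def using assms(1,2) theta_dsum[OF assms(1-4)] by (rule pairing_dsum)

end
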